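(* Let $G$ be a QI-group that is represented in a locally compact Polish group $X$ by a probability measure $\mu$; that is, there is a continuous monomorphism $G\to X$ (by means of which $G$ is identified with a subgroup of $X$), one has $E(\mu)=G$, and $\mu_g\perp\mu$ for every $g\in X\setminus G$. Then $G$, regarded as a subset of $X$, is $\sigma$-compact in $X$, i.e. it is a countable union of compact subsets of $X$.
   Context: For a Borel probability measure $\mu$ on a Polish group $X$ and $g\in X$, $\mu_g$ denotes the measure $\mu_g(E):=\mu(g^{-1}E)$ for Borel $E\subset X$. We write $\mu\sim\nu$ if the measures are equivalent (mutually absolutely continuous) and $\mu\perp\nu$ if they are mutually singular. $E(\mu):=\{g\in X:\ \mu_g\sim\mu\}$, a subgroup of $X$. A Polish group $G$ is called a group of quasi-invariance, or a QI-group, if there exist a locally compact Polish group $X$ and a Borel probability measure $\mu$ on $X$ such that $G$ is continuously embedded in $X$ (there is a continuous injective homomorphism $G\to X$, by which $G$ is identified, as an abstract group, with a subgroup of $X$; the topology of $G$ may be finer than the one induced from $X$), $E(\mu)=G$, and $\mu_g\perp\mu$ for all $g\in X\setminus E(\mu)$. In this case one says that $G$ is represented in $X$ by $\mu$. *)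

theory Defs
  imports "HOL-Probability.Probability"
begin

text \<open>
  Polish groups are types of sort \<open>{polish_space, topological_group_add}\<close>. The group operation is
  written additively, as \<open>group_add\<close> is the library's type class of groups; commutativity is not
  assumed. No relation between the chosen complete metric \<open>dist\<close> and the group operation is
  assumed, so \<open>polish_space\<close> only says that the topology is Polish.
\<close>

definition translate_measure ::
    "'x::{topological_space, group_add} \<Rightarrow> 'x measure \<Rightarrow> 'x measure" where
  "translate_measure g \<mu> = distr \<mu> borel (\<lambda>x. g + x)"

text \<open>The push-forward under left translation by \<open>g\<close> is \<open>E \<mapsto> \<mu> (g\<inverse> E)\<close>:\<close>

lemma emeasure_translate_measure:
  fixes g :: "'x::topological_group_add"
  assumes "sets \<mu> = sets borel" and "E \<in> sets borel"
  shows "emeasure (translate_measure g \<mu>) E = emeasure \<mu> ((\<lambda>x. - g + x) ` E)"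
proof -
  have "continuous_on UNIV (\<lambda>x. g + x)"
    by (intro continuous_intros)
  then have "(\<lambda>x. g + x) \<in> measurable \<mu> borel"
    using assms(1) borel_measurable_continuous_onI measurable_cong_sets by blast
  moreover have "(\<lambda>x. g + x) -` E \<inter> space \<mu> = (\<lambda>x. - g + x) ` E"
  proof -
    have "space \<mu> = UNIV"
      using sets_eq_imp_space_eq[OF assms(1)] by simp
    moreover have "x \<in> (\<lambda>x. - g + x) ` E" if "g + x \<in> E" for x
      using that by (intro image_eqI[where x = "g + x"]) (simp_all flip: add.assoc)
    ultimately show ?thesis
      by (auto simp flip: add.assoc)
  qed
  ultimately show ?thesis
    using assms(2) by (simp add: translate_measure_def emeasure_distr)
qed

definition equivalent_measures :: "'a measure \<Rightarrow> 'a measure \<Rightarrow> bool" where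
  "equivalent_measures \<mu> \<nu> \<longleftrightarrow> absolutely_continuous \<mu> \<nu> \<and> absolutely_continuous \<nu> \<mu>"

definition mutually_singular :: "'a measure \<Rightarrow> 'a measure \<Rightarrow> bool" where
  "mutually_singular \<mu> \<nu> \<longleftrightarrow>
    (\<exists>A. A \<in> sets \<mu> \<and> A \<in> sets \<nu> \<and> emeasure \<mu> A = 0 \<and> emeasure \<nu> (space \<nu> - A) = 0)"

definition quasi_invariance_set :: "'x::{topological_space, group_add} measure \<Rightarrow> 'x set" where
  "quasi_invariance_set \<mu> = {g. equivalent_measures (translate_measure g \<mu>) \<mu>}"

text \<open>
  \<open>represented_by \<phi> \<mu>\<close>: the Polish group \<open>'g\<close>, embedded by \<open>\<phi>\<close>, is represented in the locally
  compact Polish group \<open>'x\<close> by the Borel probability measure \<open>\<mu>\<close>. In particular \<open>'g\<close> is then a group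
  of quasi-invariance; the definition of the latter quantifies existentially over \<open>'x\<close>, \<open>\<phi>\<close> and \<open>\<mu>\<close>.
\<close>

definition represented_by ::
    "('g::{polish_space, topological_group_add} \<Rightarrow> 'x::{polish_space, topological_group_add})
      \<Rightarrow> 'x measure \<Rightarrow> bool" where
  "represented_by \<phi> \<mu> \<longleftrightarrow>
    locally_compact_space (euclidean :: 'x topology) \<and>
    prob_space \<mu> \<and> sets \<mu> = sets borel \<and>
    continuous_on UNIV \<phi> \<and> inj \<phi> \<and> (\<forall>a b. \<phi> (a + b) = \<phi> a + \<phi> b) \<and>
    quasi_invariance_set \<mu> = range \<phi> \<and>
    (\<forall>g. g \<notin> quasi_invariance_set \<mu> \<longrightarrow> mutually_singular (translate_measure g \<mu>) \<mu>)"

definition sigma_compact :: "'a::topological_space set \<Rightarrow> bool" where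
  "sigma_compact S \<longleftrightarrow> (\<exists>\<K>. countable \<K> \<and> (\<forall>K\<in>\<K>. compact K) \<and> S = \<Union>\<K>)"

end

theory Submission
  imports Defs
begin

text \<open>
  Absolute continuity in \<open>\<epsilon>\<close>-\<open>\<delta>\<close> form and outer regularity show that, under the dichotomy, \<open>g\<close> is
  a quasi-invariance element iff for some \<open>n\<close> every open set \<open>U\<close> with \<open>\<mu> U < 1 / (n + 1)\<close> satisfies
  \<open>\<mu> (g\<inverse> U) \<le> 1/2\<close>. For open \<open>U\<close> the function \<open>g \<mapsto> \<mu> (g\<inverse> U)\<close> is lower semicontinuous, so for
  fixed \<open>n\<close> this condition defines a closed set. Hence \<open>E(\<mu>)\<close> is an \<open>F\<^sub>\<sigma>\<close> set, and a locally compact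
  Polish space is \<open>\<sigma>\<close>-compact.
\<close>

text \<open>A failure gives sets \<open>A n\<close> with \<open>\<mu>\<close>-measure below
  \<open>(1/2)^n\<close> but \<open>\<nu>\<close>-measure at least \<open>e\<close>. By
  Borel-Cantelli their limsup is \<open>\<mu>\<close>-null, hence \<open>\<nu>\<close>-null, whereas
  continuity from above of the finite measure \<open>\<nu>\<close> gives it measure at least
  \<open>e\<close>.\<close>

lemma absolutely_continuous_epsilon_delta:
  assumes "finite_measure \<mu>" "finite_measure \<nu>" and sets_eq: "sets \<nu> = sets \<mu>"
    and ac: "absolutely_continuous \<mu> \<nu>" and "0 < e"
  shows "\<exists>d>0. \<forall>A\<in>sets \<mu>. measure \<mu> A < d \<longrightarrow> measure \<nu> A < e"
proof (rule ccontr)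
  interpret \<mu>: finite_measure \<mu> by fact
  interpret \<nu>: finite_measure \<nu> by fact
  assume "\<not> ?thesis"
  then have "\<forall>n. \<exists>A. A \<in> sets \<mu> \<and> measure \<mu> A < (1/2)^n \<and> e \<le> measure \<nu> A"
    by (metis linorder_not_le zero_less_power half_gt_zero zero_less_one)
  then obtain A where A [measurable]: "\<And>n. A n \<in> sets \<mu>"
    and small: "\<And>n. measure \<mu> (A n) < (1/2)^n" and large: "\<And>n. e \<le> measure \<nu> (A n)"
    by metis
  \<comment> \<open>The \<open>A n\<close> need not be nested. Their tail unions decrease to the
    limsup and keep the lower bound \<open>e\<close>.\<close>
  define B where "B n = (\<Union>k\<in>{n..}. A k)" for n
  have B: "range B \<subseteq> sets \<nu>" "decseq B"
    unfolding B_def sets_eq by (auto simp: decseq_def intro: order_trans)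
  have "limsup A \<in> null_sets \<mu>"
    by (rule borel_cantelli_limsup1)
       (auto simp: \<mu>.emeasure_eq_measure
             intro!: summable_comparison_test'[OF summable_geometric[of "1/2::real"], of 0]
               less_imp_le[OF small])
  moreover have "limsup A = (\<Inter>n. B n)"
    by (simp add: limsup_INF_SUP B_def)
  ultimately have "(\<Inter>n. B n) \<in> null_sets \<nu>"
    using ac unfolding absolutely_continuous_def by auto
  then have "(\<lambda>n. measure \<nu> (B n)) \<longlonglongrightarrow> 0"
    using \<nu>.finite_Lim_measure_decseq[OF B] by (simp add: null_sets_def measure_def)
  moreover have "e \<le> measure \<nu> (B n)" for n
  proof -
    have "measure \<nu> (A n) \<le> measure \<nu> (B n)"
      using B by (intro \<nu>.finite_measure_mono) (auto simp: B_def)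
    then show ?thesis
      using large[of n] by simp
  qed
  ultimately have "e \<le> 0"
    by (intro LIMSEQ_le_const) auto
  with \<open>0 < e\<close> show False by simp
qed

text \<open>This is Fatou's lemma for sets: if \<open>f n\<close> tends to \<open>g\<close> and
  \<open>g + x\<close> lies in the open set \<open>U\<close>, then \<open>f n + x\<close> lies in
  \<open>U\<close> eventually. So the preimage for \<open>g\<close> is contained in the liminf of
  the preimages for \<open>f n\<close>, which is the increasing union of the sets
  \<open>V n\<close>.\<close>

lemma closed_translate_measure_le:
  fixes \<mu> :: "'x::{first_countable_topology, topological_group_add} measure"
  assumes "finite_measure \<mu>" and sets: "sets \<mu> = sets borel" and "open U"
  shows "closed {g. measure \<mu> ((\<lambda>x. g + x) -` U) \<le> c}"
  unfolding closed_sequential_limits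
proof (intro allI impI)
  interpret finite_measure \<mu> by fact
  fix f g assume "(\<forall>n. f n \<in> {g. measure \<mu> ((\<lambda>x. g + x) -` U) \<le> c}) \<and> f \<longlonglongrightarrow> g"
  then have le: "\<And>n. measure \<mu> ((\<lambda>x. f n + x) -` U) \<le> c" and lim: "f \<longlonglongrightarrow> g"
    by auto
  have meas [measurable]: "(\<lambda>x. h + x) -` U \<in> sets \<mu>" for h
    unfolding sets using \<open>open U\<close>
    by (intro borel_open open_vimage continuous_intros)
  define V where "V n = (\<Inter>k\<in>{n..}. (\<lambda>x. f k + x) -` U)" for n
  have V: "range V \<subseteq> sets \<mu>" "incseq V"
    unfolding V_def by (auto simp: incseq_def intro!: sets.countable_INT')
  have "(\<lambda>x. g + x) -` U \<subseteq> (\<Union>n. V n)"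
  proof
    fix x assume "x \<in> (\<lambda>x. g + x) -` U"
    moreover have "(\<lambda>n. f n + x) \<longlonglongrightarrow> g + x"
      by (intro tendsto_intros lim)
    ultimately have "\<forall>\<^sub>F n in sequentially. f n + x \<in> U"
      using \<open>open U\<close> by (auto dest: topological_tendstoD)
    then show "x \<in> (\<Union>n. V n)"
      by (auto simp: V_def eventually_sequentially)
  qed
  then have "measure \<mu> ((\<lambda>x. g + x) -` U) \<le> measure \<mu> (\<Union>n. V n)"
    using V by (intro finite_measure_mono) auto
  also have "\<dots> \<le> c"
  proof (rule LIMSEQ_le_const2[OF finite_Lim_measure_incseq[OF V]])
    have "measure \<mu> (V n) \<le> measure \<mu> ((\<lambda>x. f n + x) -` U)" for n
      by (intro finite_measure_mono) (auto simp: V_def)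
    then show "\<exists>N. \<forall>n\<ge>N. measure \<mu> (V n) \<le> c"
      using le order_trans by blast
  qed
  finally show "g \<in> {g. measure \<mu> ((\<lambda>x. g + x) -` U) \<le> c}"
    by simp
qed

text \<open>By Lindelof, countably many of the open sets \<open>U x\<close> cover the space, and so
  do the compact sets \<open>K x\<close> around them.\<close>

lemma sigma_compact_UNIV:
  assumes "locally_compact_space (euclidean :: 'a::second_countable_topology topology)"
  shows "sigma_compact (UNIV :: 'a set)"
proof -
  have "\<forall>x::'a. \<exists>U K. open U \<and> compact K \<and> x \<in> U \<and> U \<subseteq> K"
    using assms by (simp add: locally_compact_space_def)
  then obtain U K :: "'a \<Rightarrow> 'a set" where UK: "\<And>x. open (U x)" "\<And>x. compact (K x)"
      "\<And>x. x \<in> U x" "\<And>x. U x \<subseteq> K x"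
    by metis
  obtain \<F> where \<F>: "\<F> \<subseteq> range U" "countable \<F>" "\<Union>\<F> = \<Union>(range U)"
    using Lindelof[of "range U"] UK(1) by blast
  obtain I where I: "countable I" "\<F> = U ` I"
    using \<F>(1,2) by (meson countable_subset_image)
  have "x \<in> \<Union>(K ` I)" for x
    using \<F>(3) UK(3)[of x] UK(4) unfolding I by blast
  then have "UNIV = \<Union>(K ` I)"
    by blast
  then show ?thesis
    unfolding sigma_compact_def using I(1) UK(2) by blast
qed

lemma sigma_compact_Int_closed:
  assumes "sigma_compact S" "closed C"
  shows "sigma_compact (S \<inter> C)"
proof -
  obtain \<K> where "countable \<K>" "\<forall>K\<in>\<K>. compact K" "S = \<Union>\<K>"
    using assms(1) unfolding sigma_compact_def by blast
  then show ?thesis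
    unfolding sigma_compact_def using assms(2)
    by (intro exI[of _ "(\<lambda>K. K \<inter> C) ` \<K>"]) (auto intro: compact_Int_closed)
qed

lemma sigma_compact_UN:
  assumes "countable I" "\<And>i. i \<in> I \<Longrightarrow> sigma_compact (S i)"
  shows "sigma_compact (\<Union>i\<in>I. S i)"
proof -
  obtain \<K> where "\<And>i. i \<in> I \<Longrightarrow> countable (\<K> i) \<and> (\<forall>K\<in>\<K> i. compact K) \<and> S i = \<Union>(\<K> i)"
    using assms(2) unfolding sigma_compact_def by metis
  then show ?thesis
    unfolding sigma_compact_def using assms(1)
    by (intro exI[of _ "\<Union>i\<in>I. \<K> i"]) auto
qed

theorem proposition1:
  fixes \<phi> :: "'g::{polish_space, topological_group_add} \<Rightarrow> 'x::{polish_space, topological_group_add}"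
    and \<mu> :: "'x measure"
  assumes "represented_by \<phi> \<mu>"
  shows "sigma_compact (range \<phi>)"
proof -
  have lc: "locally_compact_space (euclidean :: 'x topology)" and "prob_space \<mu>"
    and sets: "sets \<mu> = sets borel" and E: "quasi_invariance_set \<mu> = range \<phi>"
    and singular: "\<And>g. g \<notin> range \<phi> \<Longrightarrow> mutually_singular (translate_measure g \<mu>) \<mu>"
    using assms unfolding represented_by_def by auto
  interpret prob_space \<mu> by fact
  have space: "space \<mu> = UNIV"
    using sets_eq_imp_space_eq[OF sets] by simp
  have shift [measurable]: "(\<lambda>x. g + x) \<in> measurable \<mu> borel" for g
    unfolding measurable_cong_sets[OF sets refl]
    by (intro borel_measurable_continuous_onI continuous_intros)
  have sets_tr: "sets (translate_measure g \<mu>) = sets borel" for g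
    by (simp add: translate_measure_def)
  have tr: "prob_space (translate_measure g \<mu>)" for g
    unfolding translate_measure_def by (intro prob_space_distr shift)
  have measure_tr: "measure (translate_measure g \<mu>) A = prob ((\<lambda>x. g + x) -` A)"
    if "A \<in> sets borel" for g A
    using that by (simp add: translate_measure_def measure_distr space)
  \<comment> \<open>The threshold plays the role of \<open>d\<close> for \<open>e = 1/2\<close>. The
    non-strict bound makes each condition closed, so even this uncountable intersection is closed.
    \<open>Suc\<close> matters: since \<open>1 / 0 = 0\<close>, the threshold
    \<open>1 / real n\<close> would admit no \<open>U\<close> at \<open>n = 0\<close>, and
    \<open>F 0\<close> would be the whole group.\<close>
  define F where "F n = (\<Inter>U\<in>{U. open U \<and> prob U < 1 / real (Suc n)}.
      {g. prob ((\<lambda>x. g + x) -` U) \<le> 1/2})" for n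
  have closed_F: "closed (F n)" for n
    unfolding F_def
    by (intro closed_INT ballI closed_translate_measure_le finite_measure_axioms sets) auto
  have "range \<phi> = (\<Union>n. F n)"
  proof (intro equalityI subsetI)
    fix g assume "g \<in> range \<phi>"
    then have "absolutely_continuous \<mu> (translate_measure g \<mu>)"
      unfolding E[symmetric] by (simp add: quasi_invariance_set_def equivalent_measures_def)
    then obtain d where "d > 0"
      and d: "\<And>A. A \<in> sets borel \<Longrightarrow> prob A < d \<Longrightarrow> measure (translate_measure g \<mu>) A < 1/2"
      using absolutely_continuous_epsilon_delta[of \<mu> "translate_measure g \<mu>" "1/2"] tr[of g]
      by (auto simp: finite_measure_axioms prob_space_def sets sets_tr)
    obtain n where "1 / real (Suc n) < d"
      using \<open>d > 0\<close> nat_approx_posE by blast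
    then have "prob ((\<lambda>x. g + x) -` U) \<le> 1/2" if "open U" "prob U < 1 / real (Suc n)" for U
      using d[of U] that by (simp add: measure_tr)
    then have "g \<in> F n"
      unfolding F_def by blast
    then show "g \<in> (\<Union>n. F n)" by blast
  next
    fix g assume "g \<in> (\<Union>n. F n)"
    then obtain n where n: "g \<in> F n" by blast
    show "g \<in> range \<phi>"
    proof (rule ccontr)
      assume "g \<notin> range \<phi>"
      then obtain A where A: "A \<in> sets borel" "emeasure (translate_measure g \<mu>) A = 0"
          "emeasure \<mu> (- A) = 0"
        using singular[of g] unfolding mutually_singular_def
        by (auto simp: sets sets_tr space Compl_eq_Diff_UNIV)
      \<comment> \<open>The set \<open>- A\<close> is \<open>\<mu>\<close>-null but carries the
        whole translated measure. An open \<open>U\<close> around it can be chosen below the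
        threshold of \<open>F n\<close>, yet its translated measure is 1, contradicting the bound
        1/2.\<close>
      have "(INF U\<in>{U. - A \<subseteq> U \<and> open U}. emeasure \<mu> U) = 0"
        using outer_regular[OF sets, of "- A"] A by (simp add: borel_comp)
      then have "(INF U\<in>{U. - A \<subseteq> U \<and> open U}. emeasure \<mu> U) < ennreal (1 / real (Suc n))"
        by simp
      then obtain U where U: "- A \<subseteq> U" "open U" "emeasure \<mu> U < ennreal (1 / real (Suc n))"
        unfolding INF_less_iff by blast
      interpret tr: prob_space "translate_measure g \<mu>" by (rule tr)
      have "prob U < 1 / real (Suc n)"
        using U(3) by (simp add: emeasure_eq_measure ennreal_less_iff)
      then have "prob ((\<lambda>x. g + x) -` U) \<le> 1/2"
        using n U(2) unfolding F_def by blast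
      moreover have "tr.prob (- A) = 1"
        using tr.prob_compl[of A] A
        by (simp add: sets_tr translate_measure_def measure_def Compl_eq_Diff_UNIV)
      moreover have "tr.prob (- A) \<le> tr.prob U"
        using U by (intro tr.finite_measure_mono) (auto simp: sets_tr)
      ultimately show False
        using U(2) by (simp add: measure_tr)
    qed
  qed
  moreover have "sigma_compact (F n)" for n
    using sigma_compact_Int_closed[OF sigma_compact_UNIV[OF lc] closed_F] by simp
  ultimately show ?thesis
    using sigma_compact_UN[of UNIV F] by simp
qed

end
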